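(* Any residuated lattice satisfying either $x\backslash x\approx\mathrm{e}$ or $x/x\approx\mathrm{e}$ is integrally closed and $\mathrm{e}$-cyclic.
   Context: A residuated lattice is an algebra $\langle A,\wedge,\vee,\cdot,\backslash,/,\mathrm{e}\rangle$ such that $\langle A,\wedge,\vee\rangle$ is a lattice, $\langle A,\cdot,\mathrm{e}\rangle$ is a monoid, and for all $a,b,c\in A$: $b\le a\backslash c \iff ab\le c\iff a\le c/b$. It is integrally closed if it satisfies $xy\le x\Rightarrow y\le \mathrm{e}$ and $yx\le x\Rightarrow y\le\mathrm{e}$, or equivalently, both equations $x\backslash x\approx\mathrm{e}$ and $x/x\approx\mathrm{e}$. It is $\mathrm{e}$-cyclic if $a\backslash\mathrm{e}=\mathrm{e}/a$ for all $a\in A$. *)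

theory Defs imports Main begin

text \<open>
  The carrier of the algebra is the whole type, the lattice operations are \<^const>\<open>inf\<close> and
  \<^const>\<open>sup\<close>, and the monoid unit \<open>e\<close> is \<^term>\<open>1\<close>, which need not be the top element.
  The residuals get their own symbols, since \<open>/\<close> already denotes the division of \<^class>\<open>inverse\<close>.
\<close>

class residuated_lattice = lattice + monoid_mult +
  fixes left_residual :: "'a \<Rightarrow> 'a \<Rightarrow> 'a"  (infix "\<setminus>" 75)
    and right_residual :: "'a \<Rightarrow> 'a \<Rightarrow> 'a"  (infix "\<sslash>" 75)
  assumes left_residuation: "b \<le> a \<setminus> c \<longleftrightarrow> a * b \<le> c"
    and right_residuation: "a * b \<le> c \<longleftrightarrow> a \<le> c \<sslash> b"

definition integrally_closed :: "'a::residuated_lattice itself \<Rightarrow> bool" where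
  "integrally_closed _ \<longleftrightarrow>
    (\<forall>x y :: 'a. x * y \<le> x \<longrightarrow> y \<le> 1) \<and> (\<forall>x y :: 'a. y * x \<le> x \<longrightarrow> y \<le> 1)"

definition e_cyclic :: "'a::residuated_lattice itself \<Rightarrow> bool" where
  "e_cyclic _ \<longleftrightarrow> (\<forall>a :: 'a. a \<setminus> 1 = 1 \<sslash> a)"

end

theory Submission imports Defs begin

text \<open>
  Suppose \<open>x \<setminus> x = 1\<close> for all \<open>x\<close>, so that \<open>x * y \<le> x\<close> implies \<open>y \<le> 1\<close>. If \<open>a * b \<le> 1\<close>, then
  \<open>a * (b * a) = (a * b) * a \<le> a\<close> and so \<open>b * a \<le> 1\<close>; this is \<open>e\<close>-cyclicity. If \<open>y * x \<le> x\<close>, put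
  \<open>z = x \<setminus> 1\<close>; then \<open>y * x * z \<le> x * z \<le> 1\<close>, and rotating the product gives \<open>x * z * y \<le> 1\<close>, i.e.
  \<open>z * y \<le> z\<close>, whence \<open>y \<le> 1\<close>. The other case is the mirror image.
\<close>

context residuated_lattice
begin

lemma mult_left_mono_residuated: "b \<le> c \<Longrightarrow> a * b \<le> a * c"
  by (meson left_residuation order.refl order.trans)

lemma mult_right_mono_residuated: "a \<le> b \<Longrightarrow> a * c \<le> b * c"
  by (meson right_residuation order.refl order.trans)

lemma mult_le_one_commute_of_left_cancel:
  assumes "\<And>x y. x * y \<le> x \<Longrightarrow> y \<le> 1" and "a * b \<le> 1"
  shows "b * a \<le> 1"
  using assms(1)[of a "b * a"] mult_right_mono_residuated[OF assms(2), of a]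
  by (simp add: mult.assoc)

text \<open>Multiplying \<open>a * b \<le> 1\<close> by \<open>b\<close> on the left gives
  \<open>(b * a) * b \<le> b\<close>, and the last \<open>b\<close> cancels.\<close>

lemma mult_le_one_commute_of_right_cancel:
  assumes "\<And>x y. y * x \<le> x \<Longrightarrow> y \<le> 1" and "a * b \<le> 1"
  shows "b * a \<le> 1"
  using assms(1)[of "b * a" b] mult_left_mono_residuated[OF assms(2), of b]
  by (simp add: mult.assoc)

lemma right_cancel_of_left_cancel:
  assumes cancel: "\<And>x y. x * y \<le> x \<Longrightarrow> y \<le> 1" and "y * x \<le> x"
  shows "y \<le> 1"
proof -
  let ?z = "x \<setminus> 1"
  have "y * x * ?z \<le> x * ?z"
    using assms(2) by (rule mult_right_mono_residuated)
  also have "x * ?z \<le> 1"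
    by (simp flip: left_residuation)
  finally have "x * (?z * y) \<le> 1"
    using mult_le_one_commute_of_left_cancel[of y "x * ?z", OF cancel]
    by (simp add: mult.assoc)
  then have "?z * y \<le> ?z"
    by (simp add: left_residuation)
  then show ?thesis
    by (rule cancel)
qed

lemma left_cancel_of_right_cancel:
  assumes cancel: "\<And>x y. y * x \<le> x \<Longrightarrow> y \<le> 1" and "x * y \<le> x"
  shows "y \<le> 1"
proof -
  let ?z = "1 \<sslash> x"
  have "?z * (x * y) \<le> ?z * x"
    using assms(2) by (rule mult_left_mono_residuated)
  also have "?z * x \<le> 1"
    by (simp add: right_residuation)
  \<comment> \<open>The chain gives \<open>(?z * x) * y \<le> 1\<close>; rotation moves
    \<open>y\<close> to the front.\<close>
  finally have "y * ?z * x \<le> 1"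
    using mult_le_one_commute_of_right_cancel[of "?z * x" y, OF cancel]
    by (simp add: mult.assoc)
  then have "y * ?z \<le> ?z"
    by (simp add: right_residuation)
  then show ?thesis
    by (rule cancel)
qed

end

lemma integrally_closed_imp_e_cyclic:
  assumes "integrally_closed TYPE('a::residuated_lattice)"
  shows "e_cyclic TYPE('a)"
proof -
  have "a * b \<le> 1 \<Longrightarrow> b * a \<le> 1" for a b :: 'a
    using assms mult_le_one_commute_of_left_cancel[of a b]
    unfolding integrally_closed_def by blast
  \<comment> \<open>By residuation the two sides say \<open>a * b \<le> 1\<close> and
    \<open>b * a \<le> 1\<close>. Elements with the same lower bounds are equal.\<close>
  then have "b \<le> a \<setminus> 1 \<longleftrightarrow> b \<le> 1 \<sslash> a" for a b :: 'a
    unfolding left_residuation right_residuation[symmetric] by blast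
  then show ?thesis
    unfolding e_cyclic_def by (meson order.antisym order.refl)
qed

theorem proposition2p3:
  assumes "(\<forall>x :: 'a::residuated_lattice. x \<setminus> x = 1) \<or> (\<forall>x :: 'a. x \<sslash> x = 1)"
  shows "integrally_closed TYPE('a) \<and> e_cyclic TYPE('a)"
proof -
  have "integrally_closed TYPE('a)"
    using assms
  proof
    assume "\<forall>x :: 'a. x \<setminus> x = 1"
    then have "x * y \<le> x \<Longrightarrow> y \<le> 1" for x y :: 'a
      by (metis left_residuation)
    then show ?thesis
      unfolding integrally_closed_def using right_cancel_of_left_cancel by blast
  next
    assume "\<forall>x :: 'a. x \<sslash> x = 1"
    then have "y * x \<le> x \<Longrightarrow> y \<le> 1" for x y :: 'a
      by (metis right_residuation)
    then show ?thesis
      unfolding integrally_closed_def using left_cancel_of_right_cancel by blast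
  qed
  then show ?thesis
    using integrally_closed_imp_e_cyclic by blast
qed

end
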